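(* Let $\Omega\subset\mathbb{C}^m$ be a bounded domain. Let $K:\Omega\times\Omega\to\mathbb{C}$ be a (sesqui-analytic) non-negative definite kernel for which a continuous branch of $\log K$ exists on $\Omega\times\Omega$, and let $J:\mathrm{Aut}(\Omega)\times\Omega\to\mathbb{C}\setminus\{0\}$ be a function such that $J(\varphi,\cdot)$ is holomorphic for each $\varphi\in\mathrm{Aut}(\Omega)$. Suppose that $K$ is quasi-invariant with respect to $J$. Then, whenever $t\in G\mathcal{W}(K)$, the kernel $K^{t}(z,w)\big((\partial_i\bar\partial_j\log K)(z,w)\big)_{i,j=1}^m$ is quasi-invariant with respect to $\mathbb{J}$, where $$\mathbb{J}(\varphi,z)=J(\varphi,z)^t\,D\varphi(z)^{\mathrm{tr}},\qquad \varphi\in\mathrm{Aut}(\Omega),\ z\in\Omega.$$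
   Context: Sesqui-analytic means holomorphic in the first and anti-holomorphic in the second set of $m$ variables. $\mathrm{Aut}(\Omega)$ is the group of biholomorphic automorphisms of $\Omega$; $D\varphi(z)$ is the complex Jacobian matrix $(\partial\varphi_l/\partial z_i)_{l,i}$ and $\mathrm{tr}$ denotes transpose. $K^t:=\exp(t\log K)$ for the given branch; $\partial_i=\frac{\partial}{\partial z_i}$, $\bar\partial_j=\frac{\partial}{\partial\bar w_j}$. $J(\varphi,\cdot)^t=\exp(t\log J(\varphi,\cdot))$ for a holomorphic branch of $\log J(\varphi,\cdot)$ on $\Omega$. An $\mathcal{M}_k(\mathbb{C})$-valued function $L$ on $\Omega\times\Omega$ is non-negative definite if $\sum_{p,q}\langle L(z_p,z_q)\eta_q,\eta_p\rangle\ge0$ for all finite choices $z_p\in\Omega$, $\eta_p\in\mathbb{C}^k$. The generalized Wallach set is $G\mathcal{W}(K)=\{t\in\mathbb{R}: K^t(\partial_i\bar\partial_j\log K)_{i,j=1}^m\text{ is non-negative definite on }\Omega\times\Omega\}$. For a function $J:\mathrm{Aut}(\Omega)\times\Omega\to GL_k(\mathbb{C})$ with $J(\varphi,\cdot)$ holomorphic for each $\varphi$, a non-negative definite kernel $L:\Omega\times\Omega\to\mathcal{M}_k(\mathbb{C})$ is quasi-invariant with respect to $J$ if $$J(\varphi,z)\,L(\varphi(z),\varphi(w))\,J(\varphi,w)^*=L(z,w),\qquad z,w\in\Omega,\ \varphi\in\mathrm{Aut}(\Omega).$$ *)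

theory Defs
  imports "HOL-Analysis.Analysis"
begin

section \<open>Holomorphy and Wirtinger derivatives on \<open>\<complex>\<^sup>m\<close>\<close>

text \<open>
  The library's \<open>holomorphic_on\<close> only covers functions of one variable. On an open set of
  \<open>\<complex>\<^sup>m = complex ^ 'm\<close>, holomorphy is the existence of a complex-linear total derivative.
\<close>

definition mholomorphic_on :: "(complex ^ 'm \<Rightarrow> complex) \<Rightarrow> (complex ^ 'm) set \<Rightarrow> bool"
    (infixl "mholomorphic'_on" 50)
  where "f mholomorphic_on S \<longleftrightarrow>
    (\<forall>z\<in>S. \<exists>f'. (f has_derivative f') (at z) \<and> (\<forall>c v. f' (c *s v) = c * f' v))"

text \<open>\<open>\<partial>/\<partial>z\<^sub>i\<close>; it is only applied to functions that are holomorphic in \<open>z\<close>.\<close>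

definition pd :: "'m \<Rightarrow> (complex ^ 'm \<Rightarrow> complex) \<Rightarrow> complex ^ 'm \<Rightarrow> complex"
  where "pd i f z = deriv (\<lambda>\<zeta>. f (z + \<zeta> *s axis i 1)) 0"

text \<open>The Wirtinger operator \<open>\<partial>/\<partial>\<close>(conjugate of \<open>w\<^sub>j\<close>) \<open>= (\<partial>/\<partial>x\<^sub>j + \<i> \<partial>/\<partial>y\<^sub>j) / 2\<close>, where \<open>w\<^sub>j = x\<^sub>j + \<i> y\<^sub>j\<close>.\<close>

definition pd_bar :: "'m \<Rightarrow> (complex ^ 'm \<Rightarrow> complex) \<Rightarrow> complex ^ 'm \<Rightarrow> complex"
  where "pd_bar j f w =
    (vector_derivative (\<lambda>s::real. f (w + of_real s *s axis j 1)) (at 0)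
     + \<i> * vector_derivative (\<lambda>s::real. f (w + of_real s *s axis j \<i>)) (at 0)) / 2"

text \<open>Row \<open>l\<close>, column \<open>i\<close> is \<open>\<partial>\<phi>\<^sub>l/\<partial>z\<^sub>i\<close>.\<close>

definition jacobian_matrix ::
    "(complex ^ 'm \<Rightarrow> complex ^ 'n) \<Rightarrow> complex ^ 'm \<Rightarrow> complex ^ 'm ^ 'n"
  where "jacobian_matrix \<phi> z = (\<chi> l i. pd i (\<lambda>x. \<phi> x $ l) z)"

text \<open>
  Automorphisms are taken to be \<open>undefined\<close> outside \<open>\<Omega>\<close>, so that two elements of
  \<open>Aut \<Omega>\<close> are equal iff they agree on \<open>\<Omega>\<close>.
\<close>

definition Aut :: "(complex ^ 'm) set \<Rightarrow> (complex ^ 'm \<Rightarrow> complex ^ 'm) set"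
  where "Aut \<Omega> = {\<phi> \<in> extensional \<Omega>. bij_betw \<phi> \<Omega> \<Omega>
    \<and> (\<forall>l. (\<lambda>z. \<phi> z $ l) mholomorphic_on \<Omega>)
    \<and> (\<forall>l. (\<lambda>z. inv_into \<Omega> \<phi> z $ l) mholomorphic_on \<Omega>)}"

section \<open>Kernels\<close>

text \<open>
  Holomorphy in \<open>z\<close> and anti-holomorphy in \<open>w\<close> are required separately; by Hartogs' theorem this is
  the same as joint holomorphy in \<open>z\<close> and the conjugate of \<open>w\<close>.
\<close>

definition sesqui_analytic :: "(complex ^ 'm) set \<Rightarrow> (complex ^ 'm \<Rightarrow> complex ^ 'm \<Rightarrow> complex) \<Rightarrow> bool"
  where "sesqui_analytic \<Omega> K \<longleftrightarrow>
    (\<forall>w\<in>\<Omega>. (\<lambda>z. K z w) mholomorphic_on \<Omega>) \<and>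
    (\<forall>z\<in>\<Omega>. (\<lambda>w. cnj (K z w)) mholomorphic_on \<Omega>)"

definition cscale :: "complex \<Rightarrow> complex ^ 'n ^ 'k \<Rightarrow> complex ^ 'n ^ 'k"
  where "cscale c A = map_matrix (\<lambda>a. c * a) A"

definition adjoint_matrix :: "complex ^ 'n ^ 'k \<Rightarrow> complex ^ 'k ^ 'n"
  where "adjoint_matrix A = transpose (map_matrix cnj A)"

definition cinner :: "complex ^ 'k \<Rightarrow> complex ^ 'k \<Rightarrow> complex"
  where "cinner x y = (\<Sum>a\<in>UNIV. x $ a * cnj (y $ a))"

definition nonneg_definite ::
    "(complex ^ 'm) set \<Rightarrow> (complex ^ 'm \<Rightarrow> complex ^ 'm \<Rightarrow> complex ^ 'k ^ 'k) \<Rightarrow> bool"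
  where "nonneg_definite \<Omega> L \<longleftrightarrow>
    (\<forall>(n::nat) z \<eta>. (\<forall>p<n. z p \<in> \<Omega>) \<longrightarrow>
      (\<Sum>p<n. \<Sum>q<n. cinner (L (z p) (z q) *v \<eta> q) (\<eta> p)) \<in> \<real>\<^sub>\<ge>\<^sub>0)"

definition quasi_invariant ::
    "(complex ^ 'm) set \<Rightarrow> ((complex ^ 'm \<Rightarrow> complex ^ 'm) \<Rightarrow> complex ^ 'm \<Rightarrow> complex ^ 'k ^ 'k)
      \<Rightarrow> (complex ^ 'm \<Rightarrow> complex ^ 'm \<Rightarrow> complex ^ 'k ^ 'k) \<Rightarrow> bool"
  where "quasi_invariant \<Omega> J L \<longleftrightarrow>
    (\<forall>\<phi>\<in>Aut \<Omega>. \<forall>z\<in>\<Omega>. invertible (J \<phi> z)) \<and>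
    (\<forall>\<phi>\<in>Aut \<Omega>. \<forall>a b. (\<lambda>z. J \<phi> z $ a $ b) mholomorphic_on \<Omega>) \<and>
    nonneg_definite \<Omega> L \<and>
    (\<forall>\<phi>\<in>Aut \<Omega>. \<forall>z\<in>\<Omega>. \<forall>w\<in>\<Omega>.
      J \<phi> z ** L (\<phi> z) (\<phi> w) ** adjoint_matrix (J \<phi> w) = L z w)"

text \<open>Scalar kernels and multipliers are the case \<open>k = 1\<close> of the matrix-valued notions.\<close>

definition scalar_matrix :: "complex \<Rightarrow> complex ^ 1 ^ 1"
  where "scalar_matrix c = mat c"

section \<open>Branches of the logarithm and the generalized Wallach set\<close>

definition cont_log_kernel :: "(complex ^ 'm) set \<Rightarrow> (complex ^ 'm \<Rightarrow> complex ^ 'm \<Rightarrow> complex)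
    \<Rightarrow> (complex ^ 'm \<Rightarrow> complex ^ 'm \<Rightarrow> complex) \<Rightarrow> bool"
  where "cont_log_kernel \<Omega> K logK \<longleftrightarrow>
    continuous_on (\<Omega> \<times> \<Omega>) (\<lambda>(z, w). logK z w) \<and>
    (\<forall>z\<in>\<Omega>. \<forall>w\<in>\<Omega>. exp (logK z w) = K z w)"

definition holo_log :: "(complex ^ 'm) set \<Rightarrow> (complex ^ 'm \<Rightarrow> complex)
    \<Rightarrow> (complex ^ 'm \<Rightarrow> complex) \<Rightarrow> bool"
  where "holo_log \<Omega> f l \<longleftrightarrow> l mholomorphic_on \<Omega> \<and> (\<forall>z\<in>\<Omega>. exp (l z) = f z)"

text \<open>
  \<open>K\<^sup>t\<close> times the matrix of mixed derivatives of \<open>log K\<close>. Since \<open>K\<^sup>t\<close> is \<open>exp (t log K)\<close>, both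
  factors depend only on the chosen branch of \<open>log K\<close>. In the \<open>(i, j)\<close> entry, the derivative
  in \<open>w\<close> is taken first.
\<close>

definition curvature_kernel :: "real \<Rightarrow> (complex ^ 'm \<Rightarrow> complex ^ 'm \<Rightarrow> complex)
    \<Rightarrow> complex ^ 'm \<Rightarrow> complex ^ 'm \<Rightarrow> complex ^ 'm ^ 'm"
  where "curvature_kernel t logK z w =
    cscale (exp (of_real t * logK z w)) (\<chi> i j. pd i (\<lambda>x. pd_bar j (\<lambda>y. logK x y) w) z)"

definition gen_Wallach_set :: "(complex ^ 'm) set
    \<Rightarrow> (complex ^ 'm \<Rightarrow> complex ^ 'm \<Rightarrow> complex) \<Rightarrow> real set"
  where "gen_Wallach_set \<Omega> logK = {t. nonneg_definite \<Omega> (curvature_kernel t logK)}"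

end

theory Submission
  imports Defs "HOL-Complex_Analysis.Cauchy_Integral_Formula"
begin

text \<open>Why the curvature kernel is quasi-invariant. Taking logarithms in
  \<open>J \<phi> z * K (\<phi> z) (\<phi> w) * cnj (J \<phi> w) = K z w\<close> gives
  \<open>logK z w = logK (\<phi> z) (\<phi> w) + l z + cnj (l w)\<close>, where \<open>l\<close> is a logarithm of \<open>J \<phi>\<close>.
  A priori this holds only up to a multiple of \<open>2 \<pi> \<i>\<close>, which is constant because
  \<open>\<Omega> \<times> \<Omega>\<close> is connected, and zero because \<open>K\<close> is positive on the diagonal
  (\<open>log_kernel_transformation\<close>). Multiplying by \<open>t\<close> and exponentiating yields the
  transformation law of \<open>K\<^sup>t\<close> with multiplier \<open>exp (t * l z)\<close>. Applying the mixed derivative kills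
  the terms \<open>l z\<close> and \<open>cnj (l w)\<close>, and the chain rule contributes the Jacobian matrix of \<open>\<phi>\<close>
  at \<open>z\<close> and its conjugate at \<open>w\<close> (\<open>curvature_transformation\<close>). The product of the two laws is
  the claim; the same logarithmic identity with \<open>w\<close> frozen shows that \<open>J \<phi>\<close> has a holomorphic
  logarithm in the first place (\<open>holo_log_multiplier_exists\<close>).

  The analytic work is to justify differentiating twice. Holomorphy is given as the mere existence of
  a complex-linear total derivative. Cauchy's integral formula along coordinate discs
  (\<open>pd_Cauchy_integral\<close>) shows that partial derivatives depend continuously on parameters, whence
  integrals of holomorphic families are holomorphic (\<open>mholomorphic_on_integral\<close>). Applied to Cauchy
  integrals themselves, this gives that partial derivatives of holomorphic functions are holomorphic
  (\<open>mholomorphic_on_pd\<close>), needed for the entries of the new multiplier, and that the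
  antiholomorphic derivative of \<open>logK\<close> in \<open>w\<close> is still holomorphic in \<open>z\<close>
  (\<open>mholomorphic_on_pd_bar\<close>), needed for the second chain rule.\<close>

section \<open>Calculus of holomorphic functions of several variables\<close>

lemma bounded_linear_scalar_line: "bounded_linear (\<lambda>c::complex. c *s (v :: complex ^ 'm))"
  unfolding linear_conv_bounded_linear[symmetric]
  by (rule linearI) (simp_all add: vec_eq_iff distrib_right)

lemma has_field_derivative_along_line:
  fixes f :: "complex ^ 'm \<Rightarrow> complex"
  assumes "(f has_derivative f') (at (z + \<zeta> *s u))" and "\<And>c v. f' (c *s v) = c * f' v"
  shows "((\<lambda>\<zeta>. f (z + \<zeta> *s u)) has_field_derivative f' u) (at \<zeta>)"
proof -
  have "((\<lambda>\<zeta>::complex. z + \<zeta> *s u) has_derivative (\<lambda>c. c *s u)) (at \<zeta>)"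
    using has_derivative_add[OF has_derivative_const
        bounded_linear.has_derivative[OF bounded_linear_scalar_line has_derivative_ident]]
    by simp
  from this assms(1) have "((\<lambda>\<zeta>. f (z + \<zeta> *s u)) has_derivative (\<lambda>c. f' (c *s u))) (at \<zeta>)"
    by (rule diff_chain_at[unfolded o_def])
  then show ?thesis
    by (simp add: has_field_derivative_def assms(2) mult_commute_abs)
qed

lemma pd_eq:
  fixes f :: "complex ^ 'm \<Rightarrow> complex"
  assumes "(f has_derivative f') (at z)" and "\<And>c v. f' (c *s v) = c * f' v"
  shows "pd k f z = f' (axis k 1)"
  unfolding pd_def
  using has_field_derivative_along_line[of f f' z 0 "axis k 1"] assms by (simp add: DERIV_imp_deriv)

text \<open>Complex linearity determines the derivative from its values on the coordinate vectors. All later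
  rules compute a total derivative in this coordinate form and read off the partial derivatives with
  the converse statements \<open>mholomorphic_onI\<close> and \<open>pd_unique\<close>.\<close>

lemma mholomorphic_has_derivative:
  fixes f :: "complex ^ 'm \<Rightarrow> complex"
  assumes "f mholomorphic_on S" and "z \<in> S"
  shows "(f has_derivative (\<lambda>v. \<Sum>k\<in>UNIV. pd k f z * v $ k)) (at z)"
proof -
  obtain f' where f': "(f has_derivative f') (at z)" "\<And>c v. f' (c *s v) = c * f' v"
    using assms unfolding mholomorphic_on_def by blast
  interpret bounded_linear f' using f'(1) by (rule has_derivative_bounded_linear)
  have "f' v = (\<Sum>k\<in>UNIV. pd k f z * v $ k)" for v
  proof -
    have "f' v = f' (\<Sum>k\<in>UNIV. v $ k *s axis k 1)"
      by (simp add: basis_expansion)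
    also have "\<dots> = (\<Sum>k\<in>UNIV. pd k f z * v $ k)"
      by (simp add: sum f'(2) pd_eq[OF f'] mult.commute)
    finally show ?thesis .
  qed
  then have "f' = (\<lambda>v. \<Sum>k\<in>UNIV. pd k f z * v $ k)" by (rule ext)
  then show ?thesis using f'(1) by simp
qed

lemma mholomorphic_onI:
  fixes f :: "complex ^ 'm \<Rightarrow> complex"
  assumes "\<And>z. z \<in> S \<Longrightarrow> (f has_derivative (\<lambda>v. \<Sum>k\<in>UNIV. a z k * v $ k)) (at z)"
  shows "f mholomorphic_on S"
  unfolding mholomorphic_on_def
proof
  fix z assume "z \<in> S"
  moreover have "(\<Sum>k\<in>UNIV. a z k * (c *s v) $ k) = c * (\<Sum>k\<in>UNIV. a z k * v $ k)" for c v
    by (simp add: sum_distrib_left mult_ac)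
  ultimately show "\<exists>f'. (f has_derivative f') (at z) \<and> (\<forall>c v. f' (c *s v) = c * f' v)"
    using assms by blast
qed

lemma pd_unique:
  fixes f :: "complex ^ 'm \<Rightarrow> complex"
  assumes "(f has_derivative (\<lambda>v. \<Sum>k\<in>UNIV. a k * v $ k)) (at z)"
  shows "pd i f z = a i"
proof -
  have "pd i f z = (\<Sum>k\<in>UNIV. a k * axis i 1 $ k)"
    by (rule pd_eq[OF assms]) (simp add: sum_distrib_left mult_ac)
  also have "\<dots> = a i"
    by (simp add: axis_def if_distrib[of "(*) _"] cong: if_cong)
  finally show ?thesis .
qed

lemma mholomorphic_on_subset: "f mholomorphic_on S \<Longrightarrow> T \<subseteq> S \<Longrightarrow> f mholomorphic_on T"
  unfolding mholomorphic_on_def by blast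

lemma mholomorphic_on_imp_continuous_on:
  assumes "f mholomorphic_on S" shows "continuous_on S f"
  by (intro continuous_at_imp_continuous_on ballI
      has_derivative_continuous[OF mholomorphic_has_derivative[OF assms]])

lemma mholomorphic_locally:
  assumes "\<And>z. z \<in> S \<Longrightarrow> \<exists>U g. open U \<and> z \<in> U \<and> g mholomorphic_on U \<and> (\<forall>x\<in>U. f x = g x)"
  shows "f mholomorphic_on S"
proof (rule mholomorphic_onI)
  fix z assume "z \<in> S"
  then obtain U g where U: "open U" "z \<in> U" "g mholomorphic_on U" "\<And>x. x \<in> U \<Longrightarrow> f x = g x"
    using assms[OF \<open>z \<in> S\<close>] by auto
  have g: "(g has_derivative (\<lambda>v. \<Sum>k\<in>UNIV. pd k g z * v $ k)) (at z)"
    by (rule mholomorphic_has_derivative[OF U(3,2)])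
  then have f: "(f has_derivative (\<lambda>v. \<Sum>k\<in>UNIV. pd k g z * v $ k)) (at z)"
    by (rule has_derivative_transform_within_open[OF _ U(1,2)]) (simp add: U(4))
  then show "(f has_derivative (\<lambda>v. \<Sum>k\<in>UNIV. pd k f z * v $ k)) (at z)"
    by (simp add: pd_unique[OF f])
qed

lemma pd_cong_open:
  assumes "open U" "z \<in> U" "f mholomorphic_on U" "\<And>x. x \<in> U \<Longrightarrow> f x = g x"
  shows "pd k f z = pd k g z"
proof -
  have "(g has_derivative (\<lambda>v. \<Sum>k\<in>UNIV. pd k f z * v $ k)) (at z)"
    by (rule has_derivative_transform_within_open[OF mholomorphic_has_derivative[OF assms(3,2)] assms(1,2)])
       (simp add: assms(4))
  then show ?thesis by (simp add: pd_unique)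
qed

lemma has_derivative_vec_of_components:
  fixes \<phi> :: "complex ^ 'm \<Rightarrow> complex ^ 'n"
  assumes "\<And>l. ((\<lambda>z. \<phi> z $ l) has_derivative (\<lambda>v. \<phi>' v $ l)) (at z)"
  shows "(\<phi> has_derivative \<phi>') (at z)"
proof (subst has_derivative_componentwise_within, rule ballI)
  fix b :: "complex ^ 'n" assume "b \<in> Basis"
  then obtain l u where b: "b = axis l u" by (auto simp: Basis_vec_def)
  show "((\<lambda>x. \<phi> x \<bullet> b) has_derivative (\<lambda>x. \<phi>' x \<bullet> b)) (at z)"
    unfolding b inner_axis by (rule has_derivative_inner_left[OF assms])
qed

lemma
  fixes \<phi> :: "complex ^ 'm \<Rightarrow> complex ^ 'n"
  assumes "f mholomorphic_on T" and "\<And>l. (\<lambda>z. \<phi> z $ l) mholomorphic_on S" and "\<phi> ` S \<subseteq> T"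
  shows mholomorphic_on_compose: "(\<lambda>z. f (\<phi> z)) mholomorphic_on S"
    and pd_compose: "z \<in> S \<Longrightarrow>
      pd i (\<lambda>z. f (\<phi> z)) z = (\<Sum>l\<in>UNIV. pd l f (\<phi> z) * jacobian_matrix \<phi> z $ l $ i)"
proof -
  have chain: "((\<lambda>z. f (\<phi> z)) has_derivative (\<lambda>v. \<Sum>i\<in>UNIV.
      (\<Sum>l\<in>UNIV. pd l f (\<phi> z) * jacobian_matrix \<phi> z $ l $ i) * v $ i)) (at z)" if "z \<in> S" for z
  proof -
    have "(\<phi> has_derivative (\<lambda>v. \<chi> l. \<Sum>i\<in>UNIV. pd i (\<lambda>z. \<phi> z $ l) z * v $ i)) (at z)"
      by (rule has_derivative_vec_of_components)
         (simp add: mholomorphic_has_derivative[OF assms(2) that])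
    moreover have "(f has_derivative (\<lambda>v. \<Sum>l\<in>UNIV. pd l f (\<phi> z) * v $ l)) (at (\<phi> z))"
      using assms(3) that by (intro mholomorphic_has_derivative[OF assms(1)]) blast
    ultimately have "(f \<circ> \<phi> has_derivative (\<lambda>v. \<Sum>l\<in>UNIV. pd l f (\<phi> z) * v $ l) \<circ>
        (\<lambda>v. \<chi> l. \<Sum>i\<in>UNIV. pd i (\<lambda>z. \<phi> z $ l) z * v $ i)) (at z)"
      by (rule diff_chain_at)
    moreover have "(\<Sum>l\<in>UNIV. a l * (\<Sum>i\<in>UNIV. b l i * v i)) = (\<Sum>i\<in>UNIV. (\<Sum>l\<in>UNIV. a l * b l i) * v i)"
      for a :: "'n \<Rightarrow> complex" and b and v :: "'m \<Rightarrow> complex"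
      by (simp add: sum_distrib_left sum_distrib_right mult.assoc) (rule sum.swap)
    ultimately show ?thesis
      by (simp add: o_def jacobian_matrix_def)
  qed
  show "(\<lambda>z. f (\<phi> z)) mholomorphic_on S"
    by (rule mholomorphic_onI) (rule chain)
  show "pd i (\<lambda>z. f (\<phi> z)) z = (\<Sum>l\<in>UNIV. pd l f (\<phi> z) * jacobian_matrix \<phi> z $ l $ i)" if "z \<in> S"
    by (rule pd_unique[OF chain[OF that]])
qed

lemma mholomorphic_on_const: "(\<lambda>z. c) mholomorphic_on S"
  by (rule mholomorphic_onI[where a="\<lambda>_ _. 0"]) simp

lemma pd_const: "pd k (\<lambda>z. c) z = 0"
  by (simp add: pd_def)

lemma mholomorphic_on_component: "(\<lambda>z. z $ l) mholomorphic_on S"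
  unfolding mholomorphic_on_def
  by (intro ballI exI[of _ "\<lambda>z. z $ l"] conjI bounded_linear_imp_has_derivative bounded_linear_vec_nth) simp

lemma
  assumes "f mholomorphic_on S" and "g mholomorphic_on S"
  shows mholomorphic_on_add: "(\<lambda>z. f z + g z) mholomorphic_on S"
    and pd_add: "z \<in> S \<Longrightarrow> pd k (\<lambda>z. f z + g z) z = pd k f z + pd k g z"
proof -
  have d: "((\<lambda>z. f z + g z) has_derivative (\<lambda>v. \<Sum>k\<in>UNIV. (pd k f z + pd k g z) * v $ k)) (at z)"
    if "z \<in> S" for z
    using has_derivative_add[OF mholomorphic_has_derivative[OF assms(1) that]
        mholomorphic_has_derivative[OF assms(2) that]]
    by (simp add: sum.distrib distrib_right)
  show "(\<lambda>z. f z + g z) mholomorphic_on S" by (rule mholomorphic_onI) (rule d)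
  show "z \<in> S \<Longrightarrow> pd k (\<lambda>z. f z + g z) z = pd k f z + pd k g z" by (rule pd_unique[OF d])
qed

lemma
  assumes "f mholomorphic_on S"
  shows mholomorphic_on_cmult: "(\<lambda>z. c * f z) mholomorphic_on S"
    and pd_cmult: "z \<in> S \<Longrightarrow> pd k (\<lambda>z. c * f z) z = c * pd k f z"
proof -
  have d: "((\<lambda>z. c * f z) has_derivative (\<lambda>v. \<Sum>k\<in>UNIV. (c * pd k f z) * v $ k)) (at z)"
    if "z \<in> S" for z
    using has_derivative_mult_right[OF mholomorphic_has_derivative[OF assms that], of c]
    by (simp add: sum_distrib_left mult.assoc)
  show "(\<lambda>z. c * f z) mholomorphic_on S" by (rule mholomorphic_onI) (rule d)
  show "z \<in> S \<Longrightarrow> pd k (\<lambda>z. c * f z) z = c * pd k f z" by (rule pd_unique[OF d])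
qed

lemma
  assumes "\<And>l. l \<in> I \<Longrightarrow> f l mholomorphic_on S"
  shows mholomorphic_on_sum: "(\<lambda>z. \<Sum>l\<in>I. f l z) mholomorphic_on S"
    and pd_sum: "z \<in> S \<Longrightarrow> pd k (\<lambda>z. \<Sum>l\<in>I. f l z) z = (\<Sum>l\<in>I. pd k (f l) z)"
proof -
  have d: "((\<lambda>z. \<Sum>l\<in>I. f l z) has_derivative (\<lambda>v. \<Sum>k\<in>UNIV. (\<Sum>l\<in>I. pd k (f l) z) * v $ k)) (at z)"
    if "z \<in> S" for z
  proof (rule has_derivative_eq_rhs)
    show "((\<lambda>z. \<Sum>l\<in>I. f l z) has_derivative (\<lambda>v. \<Sum>l\<in>I. \<Sum>k\<in>UNIV. pd k (f l) z * v $ k)) (at z)"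
      by (rule has_derivative_sum) (rule mholomorphic_has_derivative[OF assms that])
    show "(\<lambda>v. \<Sum>l\<in>I. \<Sum>k\<in>UNIV. pd k (f l) z * v $ k) = (\<lambda>v. \<Sum>k\<in>UNIV. (\<Sum>l\<in>I. pd k (f l) z) * v $ k)"
      unfolding sum_distrib_right by (rule ext) (rule sum.swap)
  qed
  show "(\<lambda>z. \<Sum>l\<in>I. f l z) mholomorphic_on S" by (rule mholomorphic_onI) (rule d)
  show "z \<in> S \<Longrightarrow> pd k (\<lambda>z. \<Sum>l\<in>I. f l z) z = (\<Sum>l\<in>I. pd k (f l) z)" by (rule pd_unique[OF d])
qed

lemma mholomorphic_on_mult:
  assumes "f mholomorphic_on S" and "g mholomorphic_on S"
  shows "(\<lambda>z. f z * g z) mholomorphic_on S"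
proof (rule mholomorphic_onI)
  fix z assume z: "z \<in> S"
  have "((\<lambda>z. f z * g z) has_derivative (\<lambda>v. f z * (\<Sum>k\<in>UNIV. pd k g z * v $ k)
      + (\<Sum>k\<in>UNIV. pd k f z * v $ k) * g z)) (at z)"
    by (rule has_derivative_mult[OF mholomorphic_has_derivative[OF assms(1) z]
        mholomorphic_has_derivative[OF assms(2) z]])
  also have "(\<lambda>v. f z * (\<Sum>k\<in>UNIV. pd k g z * v $ k) + (\<Sum>k\<in>UNIV. pd k f z * v $ k) * g z)
      = (\<lambda>v. \<Sum>k\<in>UNIV. (f z * pd k g z + g z * pd k f z) * v $ k)"
    unfolding sum_distrib_left sum_distrib_right sum.distrib[symmetric]
    by (intro ext sum.cong refl) (simp add: algebra_simps)
  finally show "((\<lambda>z. f z * g z) has_derivative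
      (\<lambda>v. \<Sum>k\<in>UNIV. (f z * pd k g z + g z * pd k f z) * v $ k)) (at z)" .
qed

lemma mholomorphic_on_compose_field:
  assumes "f mholomorphic_on S" and "\<And>z. z \<in> S \<Longrightarrow> h field_differentiable (at (f z))"
  shows "(\<lambda>z. h (f z)) mholomorphic_on S"
proof (rule mholomorphic_onI)
  fix z assume z: "z \<in> S"
  have "(h has_derivative (*) (deriv h (f z))) (at (f z))"
    using assms(2)[OF z] by (simp add: field_differentiable_derivI has_field_derivative_imp_has_derivative)
  from diff_chain_at[OF mholomorphic_has_derivative[OF assms(1) z] this]
  show "((\<lambda>z. h (f z)) has_derivative (\<lambda>v. \<Sum>k\<in>UNIV. (deriv h (f z) * pd k f z) * v $ k)) (at z)"
    by (simp add: o_def sum_distrib_left mult.assoc)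
qed

lemma mholomorphic_on_exp:
  assumes "f mholomorphic_on S"
  shows "(\<lambda>z. exp (f z)) mholomorphic_on S"
  by (rule mholomorphic_on_compose_field[OF assms]) (rule field_differentiable_within_exp)

text \<open>For conjugate-holomorphic \<open>f\<close> the directional derivative along \<open>\<i> e\<^sub>j\<close> is \<open>-\<i>\<close> times the one
  along \<open>e\<^sub>j\<close>, so the Wirtinger average of the two is the latter. This turns every statement
  about \<open>pd_bar\<close> into one about \<open>pd\<close>.\<close>

lemma pd_bar_eq_cnj_pd:
  fixes f :: "complex ^ 'm \<Rightarrow> complex"
  assumes "(\<lambda>w. cnj (f w)) mholomorphic_on S" and "w \<in> S"
  shows "pd_bar j f w = cnj (pd j (\<lambda>w. cnj (f w)) w)"
proof -
  obtain h' where h': "((\<lambda>w. cnj (f w)) has_derivative h') (at w)" "\<And>c v. h' (c *s v) = c * h' v"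
    using assms unfolding mholomorphic_on_def by blast
  have line: "vector_derivative (\<lambda>s::real. f (w + of_real s *s u)) (at 0) = cnj (h' u)" for u
  proof -
    have "((\<lambda>\<zeta>. cnj (f (w + \<zeta> *s u))) has_field_derivative h' u) (at (of_real 0))"
      by (rule has_field_derivative_along_line) (use h' in simp_all)
    from has_vector_derivative_cnj[OF has_vector_derivative_real_field[OF this]]
    show ?thesis by (simp add: vector_derivative_at)
  qed
  have "axis j \<i> = \<i> *s (axis j 1 :: complex ^ 'm)"
    by (simp add: vec_eq_iff axis_def)
  then show ?thesis
    unfolding pd_bar_def line pd_eq[OF h'] by (simp add: h'(2))
qed

section \<open>Holomorphy of continuous logarithms\<close>

text \<open>Near each point a continuous logarithm differs from the principal branch, applied to the quotient
  of the values of \<open>f\<close>, only by a constant; hence it is as regular as \<open>f\<close>.\<close>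

lemma mholomorphic_on_logarithm:
  assumes "f mholomorphic_on S" and "open S" and "continuous_on S l"
    and "\<And>z. z \<in> S \<Longrightarrow> exp (l z) = f z"
  shows "l mholomorphic_on S"
proof (rule mholomorphic_locally)
  fix z assume z: "z \<in> S"
  (* Here the imaginary part of l x - l z is below pi / 2, so Ln inverts exp on these values. *)
  define U where "U = S \<inter> l -` ball (l z) 1"
  have "open U"
    unfolding U_def by (rule continuous_open_preimage[OF assms(3,2) open_ball])
  have Ln: "l x = l z + Ln (f x / f z)" "f x / f z \<notin> \<real>\<^sub>\<le>\<^sub>0" if "x \<in> U" for x
  proof -
    have x: "x \<in> S" "norm (l x - l z) < 1"
      using that by (auto simp: U_def dist_norm norm_minus_commute)
    then have e: "exp (l x - l z) = f x / f z"
      using z by (simp add: exp_diff assms(4))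
    have "\<bar>Im (l x - l z)\<bar> < 1"
      using abs_Im_le_cmod[of "l x - l z"] x(2) by linarith
    then have im: "\<bar>Im (l x - l z)\<bar> < pi / 2"
      using pi_gt3 by linarith
    then have "Ln (exp (l x - l z)) = l x - l z"
      using pi_gt3 by (intro Ln_exp) linarith+
    then show "l x = l z + Ln (f x / f z)"
      by (simp add: e)
    have "0 < cos (Im (l x - l z))"
      using im by (intro cos_gt_zero_pi) linarith+
    then have "0 < Re (exp (l x - l z))"
      by (simp add: Re_exp)
    then show "f x / f z \<notin> \<real>\<^sub>\<le>\<^sub>0"
      unfolding e using complex_nonpos_Reals_iff by force
  qed
  have "(\<lambda>x. inverse (f z) * f x) mholomorphic_on U"
    by (rule mholomorphic_on_cmult[OF mholomorphic_on_subset[OF assms(1)]]) (auto simp: U_def)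
  then have "(\<lambda>x. Ln (inverse (f z) * f x)) mholomorphic_on U"
  proof (rule mholomorphic_on_compose_field)
    fix x assume "x \<in> U"
    then show "Ln field_differentiable (at (inverse (f z) * f x))"
      using Ln(2)[of x] by (intro field_differentiable_at_Ln) (simp add: divide_inverse mult.commute)
  qed
  then have "(\<lambda>x. l z + Ln (inverse (f z) * f x)) mholomorphic_on U"
    by (rule mholomorphic_on_add[OF mholomorphic_on_const])
  moreover have "\<forall>x\<in>U. l x = l z + Ln (inverse (f z) * f x)"
    using Ln(1) by (simp add: divide_inverse mult.commute)
  moreover have "z \<in> U" using z by (simp add: U_def)
  ultimately show "\<exists>U g. open U \<and> z \<in> U \<and> g mholomorphic_on U \<and> (\<forall>x\<in>U. l x = g x)"
    using \<open>open U\<close> by blast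
qed

section \<open>Cauchy integrals\<close>

lemma norm_scaled_axis: "norm (\<zeta> *s axis k (1::complex) :: complex ^ 'm) = norm \<zeta>"
proof -
  have "\<zeta> *s axis k 1 = (axis k \<zeta> :: complex ^ 'm)"
    by (simp add: vec_eq_iff axis_def)
  then show ?thesis by (simp add: norm_eq_sqrt_inner inner_axis_axis)
qed

text \<open>One radius serves both for the base point and for the discs, so that the Cauchy formula below can
  be used on a whole neighbourhood with a fixed radius.\<close>

lemma uniform_disc_radius:
  fixes U :: "(complex ^ 'm) set"
  assumes "open U" and "z \<in> U"
  obtains r where "r > 0" and "\<And>x \<zeta>. x \<in> ball z r \<Longrightarrow> norm \<zeta> \<le> r \<Longrightarrow> x + \<zeta> *s axis k 1 \<in> U"
proof -
  obtain e where e: "e > 0" "ball z e \<subseteq> U"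
    using assms open_contains_ball by blast
  have "x + \<zeta> *s axis k 1 \<in> U" if "x \<in> ball z (e / 2)" "norm \<zeta> \<le> e / 2" for x \<zeta>
  proof -
    have "dist z (x + \<zeta> *s axis k 1) \<le> dist z x + norm (\<zeta> *s axis k 1 :: complex ^ 'm)"
      using dist_triangle[of z "x + \<zeta> *s axis k 1" x] by (simp add: dist_norm)
    also have "\<dots> < e" using that by (simp add: norm_scaled_axis)
    finally show ?thesis using e(2) by auto
  qed
  with e(1) show ?thesis
    by (intro that[of "e / 2"]) auto
qed

lemma circlepath_0_nonzero: "r > 0 \<Longrightarrow> circlepath 0 r s \<noteq> 0"
  by (simp add: circlepath)

lemma norm_circlepath_0: "r > 0 \<Longrightarrow> norm (circlepath 0 r s) = r"
  by (simp add: circlepath norm_mult)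

lemma continuous_on_circlepath [continuous_intros]:
  "continuous_on A g \<Longrightarrow> continuous_on A (\<lambda>x. circlepath z r (g x))"
  unfolding circlepath by (intro continuous_intros)

lemma continuous_on_scalar_line [continuous_intros]:
  fixes u :: "complex ^ 'm"
  shows "continuous_on A g \<Longrightarrow> continuous_on A (\<lambda>x. g x *s u)"
  by (rule bounded_linear.continuous_on[OF bounded_linear_scalar_line])

text \<open>Cauchy's formula for the derivative at the centre of a disc in the \<open>k\<close>-th coordinate line. The
  factor \<open>2 \<pi> \<i> \<gamma>(s)\<close> coming from the parametrization \<open>\<gamma>\<close> of the circle cancels the constant
  of the formula and one of the two powers in its denominator.\<close>

lemma pd_Cauchy_integral:
  fixes f :: "complex ^ 'm \<Rightarrow> complex"
  assumes f: "f mholomorphic_on S" and "r > 0" and disc: "\<And>\<zeta>. norm \<zeta> \<le> r \<Longrightarrow> z + \<zeta> *s axis k 1 \<in> S"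
  shows "pd k f z =
    integral {0..1} (\<lambda>s. f (z + circlepath 0 r s *s axis k 1) / circlepath 0 r s)"
proof -
  define g where "g \<zeta> = f (z + \<zeta> *s axis k 1)" for \<zeta>
  have g: "g field_differentiable (at \<zeta>)" if \<zeta>: "\<zeta> \<in> cball 0 r" for \<zeta>
  proof -
    obtain f' where "(f has_derivative f') (at (z + \<zeta> *s axis k 1))" "\<And>c v. f' (c *s v) = c * f' v"
      using f disc[of \<zeta>] \<zeta> unfolding mholomorphic_on_def by auto
    from has_field_derivative_along_line[OF this] show ?thesis
      unfolding g_def field_differentiable_def by blast
  qed
  have "(g has_field_derivative 1 / (2 * of_real pi * \<i>) *
      contour_integral (circlepath 0 r) (\<lambda>u. g u / (u - 0)\<^sup>2)) (at 0)"
  proof (rule Cauchy_derivative_integral_circlepath(2))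
    show "continuous_on (cball 0 r) g"
      by (intro continuous_at_imp_continuous_on ballI field_differentiable_imp_continuous_at g)
    show "g holomorphic_on ball 0 r"
      unfolding holomorphic_on_def by (auto intro!: field_differentiable_at_within g)
  qed (use \<open>r > 0\<close> in simp)
  then have "pd k f z = 1 / (2 * of_real pi * \<i>) * contour_integral (circlepath 0 r) (\<lambda>u. g u / u\<^sup>2)"
    unfolding pd_def g_def by (simp add: DERIV_imp_deriv)
  also have "\<dots> = 1 / (2 * of_real pi * \<i>) *
      integral {0..1} (\<lambda>s. (2 * of_real pi * \<i>) * (g (circlepath 0 r s) / circlepath 0 r s))"
  proof -
    have "g (circlepath 0 r s) / (circlepath 0 r s)\<^sup>2 * vector_derivative (circlepath 0 r) (at s)
        = (2 * of_real pi * \<i>) * (g (circlepath 0 r s) / circlepath 0 r s)" for s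
    proof -
      have "vector_derivative (circlepath 0 r) (at s) = 2 * of_real pi * \<i> * circlepath 0 r s"
        unfolding vector_derivative_circlepath by (simp add: circlepath)
      then show ?thesis
        using circlepath_0_nonzero[OF \<open>r > 0\<close>, of s] by (simp add: power2_eq_square)
    qed
    then show ?thesis
      unfolding contour_integral_integral by (simp only:)
  qed
  also have "\<dots> = integral {0..1} (\<lambda>s. g (circlepath 0 r s) / circlepath 0 r s)"
    by (subst integral_mult_right) simp
  finally show ?thesis unfolding g_def .
qed

text \<open>By Cauchy's formula a partial derivative is an integral of values of \<open>F\<close> over a circle whose
  radius can be kept fixed near a given point, so it inherits joint continuity from \<open>F\<close>. In
  particular a holomorphic function is automatically continuously differentiable.\<close>

lemma continuous_on_pd_param:
  fixes F :: "complex ^ 'm \<Rightarrow> 'b::t2_space \<Rightarrow> complex"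
  assumes "open U" and cont: "continuous_on (U \<times> Y) (\<lambda>(x, y). F x y)"
    and holo: "\<And>y. y \<in> Y \<Longrightarrow> (\<lambda>x. F x y) mholomorphic_on U"
  shows "continuous_on (U \<times> Y) (\<lambda>(x, y). pd k (\<lambda>x. F x y) x)"
  unfolding continuous_on_eq_continuous_within
proof clarify
  fix x0 y0 assume p: "x0 \<in> U" "y0 \<in> Y"
  obtain r where r: "r > 0"
    and near: "\<And>x \<zeta>. x \<in> ball x0 r \<Longrightarrow> norm \<zeta> \<le> r \<Longrightarrow> x + \<zeta> *s axis k 1 \<in> U"
    using uniform_disc_radius[OF \<open>open U\<close> p(1)] by blast
  have sub: "ball x0 r \<subseteq> U"
    using near[of _ 0] r by auto
  have "continuous_on ((ball x0 r \<times> Y) \<times> cbox 0 1)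
      (\<lambda>(p, s). F (fst p + circlepath 0 r s *s axis k 1) (snd p) / circlepath 0 r s)"
  proof -
    have "continuous_on ((ball x0 r \<times> Y) \<times> cbox 0 1)
        (\<lambda>q. (\<lambda>(x, y). F x y) (fst (fst q) + circlepath 0 r (snd q) *s axis k 1, snd (fst q)))"
    proof (rule continuous_on_compose2[OF cont])
      show "continuous_on ((ball x0 r \<times> Y) \<times> cbox 0 1)
          (\<lambda>q. (fst (fst q) + circlepath 0 r (snd q) *s axis k 1, snd (fst q)))"
        by (intro continuous_intros)
      show "(\<lambda>q. (fst (fst q) + circlepath 0 r (snd q) *s axis k 1, snd (fst q))) `
          ((ball x0 r \<times> Y) \<times> cbox 0 1) \<subseteq> U \<times> Y"
      proof (rule image_subsetI)
        fix q assume "q \<in> (ball x0 r \<times> Y) \<times> cbox (0::real) 1"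
        then have "fst (fst q) \<in> ball x0 r" "snd (fst q) \<in> Y" by (simp_all only: mem_Times_iff)
        then show "(fst (fst q) + circlepath 0 r (snd q) *s axis k 1, snd (fst q)) \<in> U \<times> Y"
          by (intro SigmaI near) (simp_all only: norm_circlepath_0[OF r] order_refl)
      qed
    qed
    moreover have "continuous_on ((ball x0 r \<times> Y) \<times> cbox 0 1) (\<lambda>q. circlepath 0 r (snd q))"
      by (intro continuous_intros)
    ultimately show ?thesis
      unfolding split_beta using r by (simp add: continuous_on_divide circlepath_0_nonzero)
  qed
  from integral_continuous_on_param[OF this]
  have "continuous_on (ball x0 r \<times> Y) (\<lambda>p. integral (cbox 0 1)
      (\<lambda>s. F (fst p + circlepath 0 r s *s axis k 1) (snd p) / circlepath 0 r s))" .
  moreover have "(\<lambda>(x, y). pd k (\<lambda>x. F x y) x) q = integral (cbox 0 1)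
      (\<lambda>s. F (fst q + circlepath 0 r s *s axis k 1) (snd q) / circlepath 0 r s)"
    if q: "q \<in> ball x0 r \<times> Y" for q
  proof -
    obtain x y where [simp]: "q = (x, y)" and x: "x \<in> ball x0 r" and y: "y \<in> Y"
      using q by blast
    show ?thesis
      using pd_Cauchy_integral[OF holo[OF y] r, of x k] near[OF x] by simp
  qed
  ultimately have "continuous_on (ball x0 r \<times> Y) (\<lambda>(x, y). pd k (\<lambda>x. F x y) x)"
    by (subst continuous_on_cong[OF refl])
  then have "continuous (at (x0, y0) within ball x0 r \<times> Y) (\<lambda>(x, y). pd k (\<lambda>x. F x y) x)"
    using r p by (simp add: continuous_on_eq_continuous_within)
  moreover have "at (x0, y0) within ball x0 r \<times> Y = at (x0, y0) within U \<times> Y"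
  proof (rule at_within_nhd[where S="ball x0 r \<times> UNIV"])
    show "ball x0 r \<times> Y \<inter> ball x0 r \<times> UNIV - {(x0, y0)} = U \<times> Y \<inter> ball x0 r \<times> UNIV - {(x0, y0)}"
      using sub by auto
  qed (use r in \<open>auto intro: open_Times\<close>)
  ultimately show "continuous (at (x0, y0) within U \<times> Y) (\<lambda>(x, y). pd k (\<lambda>x. F x y) x)"
    by simp
qed

lemma continuous_on_slice:
  assumes "continuous_on (U \<times> Y) (\<lambda>(x, y). F x y)" and "x \<in> U"
  shows "continuous_on Y (F x)"
proof -
  have "continuous_on Y (\<lambda>y. (\<lambda>(x, y). F x y) (x, y))"
    by (rule continuous_on_compose2[OF assms(1) continuous_on_Pair[OF continuous_on_const continuous_on_id]])
       (use assms(2) in auto)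
  then show ?thesis by simp
qed

text \<open>Differentiation under the integral sign; the continuity of the derivative that the Leibniz rule
  asks for is \<open>continuous_on_pd_param\<close>. A superposition of complex-linear derivatives is
  complex-linear.\<close>

lemma mholomorphic_on_integral:
  fixes F :: "complex ^ 'm \<Rightarrow> real \<Rightarrow> complex"
  assumes "open U" and cont: "continuous_on (U \<times> {0..1}) (\<lambda>(x, s). F x s)"
    and holo: "\<And>s. s \<in> {0..1} \<Longrightarrow> (\<lambda>x. F x s) mholomorphic_on U"
  shows "(\<lambda>x. integral {0..1} (F x)) mholomorphic_on U"
proof (rule mholomorphic_onI)
  fix z assume z: "z \<in> U"
  then obtain r where r: "r > 0" "ball z r \<subseteq> U"
    using \<open>open U\<close> open_contains_ball by blast
  define D where "D x s = Blinfun (\<lambda>v. \<Sum>k\<in>UNIV. pd k (\<lambda>x. F x s) x * v $ k)" for x s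
  have "bounded_linear (\<lambda>v :: complex ^ 'm. \<Sum>k\<in>UNIV. pd k (\<lambda>x. F x s) x * v $ k)" for x s
    unfolding linear_conv_bounded_linear[symmetric]
    by (rule linearI) (simp_all add: distrib_left sum.distrib scaleR_sum_right)
  then have D: "blinfun_apply (D x s) = (\<lambda>v. \<Sum>k\<in>UNIV. pd k (\<lambda>x. F x s) x * v $ k)" for x s
    unfolding D_def by (rule bounded_linear_Blinfun_apply)
  have cont_pd: "continuous_on (U \<times> {0..1}) (\<lambda>(x, s). pd k (\<lambda>x. F x s) x)" for k
    by (rule continuous_on_pd_param[OF \<open>open U\<close> cont holo])
  have cont_D: "continuous_on (U \<times> {0..1}) (\<lambda>(x, s). D x s)"
  proof (rule continuous_on_blinfun_componentwise)
    fix v :: "complex ^ 'm"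
    have "continuous_on (U \<times> {0..1}) (\<lambda>p. \<Sum>k\<in>UNIV. (\<lambda>(x, s). pd k (\<lambda>x. F x s) x) p * v $ k)"
      by (intro continuous_on_sum continuous_on_mult_right cont_pd)
    then show "continuous_on (U \<times> {0..1}) (\<lambda>p. blinfun_apply (case p of (x, s) \<Rightarrow> D x s) v)"
      by (simp add: split_beta D)
  qed
  have "((\<lambda>x. integral (cbox 0 1) (F x)) has_derivative integral (cbox 0 1) (D z)) (at z within ball z r)"
  proof (rule leibniz_rule)
    fix x assume "x \<in> ball z r"
    then show "F x integrable_on cbox 0 1"
      unfolding cbox_interval
      using r by (intro integrable_continuous_interval continuous_on_slice[OF cont]) auto
  next
    fix x and s :: real assume x: "x \<in> ball z r" and s: "s \<in> cbox 0 1"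
    show "((\<lambda>x. F x s) has_derivative blinfun_apply (D x s)) (at x within ball z r)"
      unfolding D
      by (rule has_derivative_at_withinI[OF mholomorphic_has_derivative[OF holo]]) (use x s r in auto)
  next
    show "continuous_on (ball z r \<times> cbox 0 1) (\<lambda>(x, s). D x s)"
      by (rule continuous_on_subset[OF cont_D]) (use r in auto)
  qed (use r in auto)
  then have "((\<lambda>x. integral {0..1} (F x)) has_derivative integral {0..1} (D z)) (at z)"
    using r by (simp add: at_within_open[OF _ open_ball])
  moreover have "blinfun_apply (integral {0..1} (D z)) =
      (\<lambda>v. \<Sum>k\<in>UNIV. integral {0..1} (\<lambda>s. pd k (\<lambda>x. F x s) z) * v $ k)"
  proof
    fix v
    have i1: "D z integrable_on {0..1}"
      by (rule integrable_continuous_interval[OF continuous_on_slice[OF cont_D z]])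
    have i2: "(\<lambda>s. pd k (\<lambda>x. F x s) z) integrable_on {0..1}" for k
      by (rule integrable_continuous_interval[OF continuous_on_slice[OF cont_pd z]])
    have "blinfun_apply (integral {0..1} (D z)) v = integral {0..1} (\<lambda>s. \<Sum>k\<in>UNIV. pd k (\<lambda>x. F x s) z * v $ k)"
      by (simp add: blinfun_apply_integral[OF i1] D)
    also have "\<dots> = (\<Sum>k\<in>UNIV. integral {0..1} (\<lambda>s. pd k (\<lambda>x. F x s) z * v $ k))"
      by (rule integral_sum) (auto intro: integrable_on_mult_left i2)
    also have "\<dots> = (\<Sum>k\<in>UNIV. integral {0..1} (\<lambda>s. pd k (\<lambda>x. F x s) z) * v $ k)"
      by simp
    finally show "blinfun_apply (integral {0..1} (D z)) v =
      (\<Sum>k\<in>UNIV. integral {0..1} (\<lambda>s. pd k (\<lambda>x. F x s) z) * v $ k)" .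
  qed
  ultimately show "((\<lambda>x. integral {0..1} (F x)) has_derivative
      (\<lambda>v. \<Sum>k\<in>UNIV. integral {0..1} (\<lambda>s. pd k (\<lambda>x. F x s) z) * v $ k)) (at z)"
    by simp
qed

section \<open>Derivatives of holomorphic functions are holomorphic\<close>

lemma mholomorphic_on_translate:
  fixes f :: "complex ^ 'm \<Rightarrow> complex"
  assumes "f mholomorphic_on S" and "\<And>x. x \<in> T \<Longrightarrow> x + a \<in> S"
  shows "(\<lambda>x. f (x + a)) mholomorphic_on T"
proof (rule mholomorphic_on_compose[OF assms(1)])
  show "(\<lambda>x. (x + a) $ l) mholomorphic_on T" for l
    unfolding vector_add_component
    by (rule mholomorphic_on_add[OF mholomorphic_on_component mholomorphic_on_const])
qed (use assms(2) in auto)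

text \<open>Locally a partial derivative is a Cauchy integral of translates of \<open>f\<close>, each of which is
  holomorphic.\<close>

lemma mholomorphic_on_pd:
  fixes f :: "complex ^ 'm \<Rightarrow> complex"
  assumes "open U" and f: "f mholomorphic_on U"
  shows "pd k f mholomorphic_on U"
proof (rule mholomorphic_locally)
  fix z assume "z \<in> U"
  then obtain r where r: "r > 0"
    and near: "\<And>x \<zeta>. x \<in> ball z r \<Longrightarrow> norm \<zeta> \<le> r \<Longrightarrow> x + \<zeta> *s axis k 1 \<in> U"
    using uniform_disc_radius[OF \<open>open U\<close>] by blast
  have near': "x + circlepath 0 r s *s axis k 1 \<in> U" if "x \<in> ball z r" for x s
    using that by (rule near) (simp add: norm_circlepath_0[OF r])
  let ?F = "\<lambda>x s. f (x + circlepath 0 r s *s axis k 1) / circlepath 0 r s"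
  have "(\<lambda>x. integral {0..1} (?F x)) mholomorphic_on ball z r"
  proof (rule mholomorphic_on_integral[OF open_ball])
    have "continuous_on (ball z r \<times> {0..1}) (\<lambda>q. f (fst q + circlepath 0 r (snd q) *s axis k 1))"
    proof (rule continuous_on_compose2[OF mholomorphic_on_imp_continuous_on[OF f]])
      show "continuous_on (ball z r \<times> {0..1}) (\<lambda>q. fst q + circlepath 0 r (snd q) *s axis k 1)"
        by (intro continuous_intros)
    qed (use near' in auto)
    moreover have "continuous_on (ball z r \<times> {0..1}) (\<lambda>q. circlepath 0 r (snd q))"
      by (intro continuous_intros)
    ultimately show "continuous_on (ball z r \<times> {0..1}) (\<lambda>(x, s). ?F x s)"
      unfolding split_beta using circlepath_0_nonzero[OF r] by (simp add: continuous_on_divide)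
    show "(\<lambda>x. ?F x s) mholomorphic_on ball z r" for s
    proof -
      have "(\<lambda>x. inverse (circlepath 0 r s) * f (x + circlepath 0 r s *s axis k 1)) mholomorphic_on ball z r"
        by (rule mholomorphic_on_cmult[OF mholomorphic_on_translate[OF f near']])
      then show ?thesis by (simp add: divide_inverse mult.commute)
    qed
  qed
  moreover have "pd k f x = integral {0..1} (?F x)" if "x \<in> ball z r" for x
    by (rule pd_Cauchy_integral[OF f r near[OF that]])
  moreover have "z \<in> ball z r" using r by simp
  ultimately show "\<exists>V g. open V \<and> z \<in> V \<and> g mholomorphic_on V \<and> (\<forall>x\<in>V. pd k f x = g x)"
    using open_ball by blast
qed

text \<open>The point that makes the mixed derivatives of \<open>L\<close> tractable: the antiholomorphic derivative at a
  fixed \<open>w\<close> is a Cauchy integral over \<open>y\<close>, and for each \<open>y\<close> on the contour the integrand is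
  holomorphic in \<open>x\<close>. So the chain rule can be applied to it once more in \<open>x\<close>.\<close>

lemma mholomorphic_on_pd_bar:
  fixes L :: "complex ^ 'm \<Rightarrow> complex ^ 'n \<Rightarrow> complex"
  assumes "open U" and "open V" and cont: "continuous_on (U \<times> V) (\<lambda>(x, y). L x y)"
    and holo: "\<And>y. y \<in> V \<Longrightarrow> (\<lambda>x. L x y) mholomorphic_on U"
    and anti: "\<And>x. x \<in> U \<Longrightarrow> (\<lambda>y. cnj (L x y)) mholomorphic_on V"
    and w: "w \<in> V"
  shows "(\<lambda>x. pd_bar j (L x) w) mholomorphic_on U"
proof -
  obtain r where r: "r > 0" "cball w r \<subseteq> V"
    using \<open>open V\<close> w open_contains_cball by blast
  have near: "w + \<zeta> *s axis j 1 \<in> V" if "norm \<zeta> \<le> r" for \<zeta>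
    using r(2) that by (auto simp: dist_norm norm_scaled_axis)
  have near': "w + circlepath 0 r s *s axis j 1 \<in> V" for s
    by (rule near) (simp add: norm_circlepath_0[OF r(1)])
  let ?F = "\<lambda>x s. L x (w + circlepath 0 r s *s axis j 1) / cnj (circlepath 0 r s)"
  have eq: "pd_bar j (L x) w = integral {0..1} (?F x)" if "x \<in> U" for x
  proof -
    have "pd j (\<lambda>y. cnj (L x y)) w = integral {0..1}
        (\<lambda>s. cnj (L x (w + circlepath 0 r s *s axis j 1)) / circlepath 0 r s)"
      by (rule pd_Cauchy_integral[OF anti[OF that] r(1) near])
    then show ?thesis
      by (simp add: pd_bar_eq_cnj_pd[OF anti[OF that] w] integral_cnj)
  qed
  have "(\<lambda>x. integral {0..1} (?F x)) mholomorphic_on U"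
  proof (rule mholomorphic_on_integral[OF \<open>open U\<close>])
    have "continuous_on (U \<times> {0..1})
        (\<lambda>q. (\<lambda>(x, y). L x y) (fst q, w + circlepath 0 r (snd q) *s axis j 1))"
    proof (rule continuous_on_compose2[OF cont])
      show "continuous_on (U \<times> {0..1}) (\<lambda>q. (fst q, w + circlepath 0 r (snd q) *s axis j 1))"
        by (intro continuous_intros)
    qed (use near' in auto)
    moreover have "continuous_on (U \<times> {0..1}) (\<lambda>q. cnj (circlepath 0 r (snd q)))"
      by (intro continuous_intros)
    ultimately show "continuous_on (U \<times> {0..1}) (\<lambda>(x, s). ?F x s)"
      unfolding split_beta using circlepath_0_nonzero[OF r(1)] by (simp add: continuous_on_divide)
    show "(\<lambda>x. ?F x s) mholomorphic_on U" for s
    proof -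
      have "(\<lambda>x. inverse (cnj (circlepath 0 r s)) * L x (w + circlepath 0 r s *s axis j 1)) mholomorphic_on U"
        by (rule mholomorphic_on_cmult[OF holo[OF near']])
      then show ?thesis by (simp add: divide_inverse mult.commute)
    qed
  qed
  then show ?thesis
    using \<open>open U\<close> eq by (intro mholomorphic_locally) blast
qed

section \<open>Automorphisms and scalar kernels\<close>

lemma invertible_cscale_transpose:
  fixes A :: "complex ^ 'n ^ 'n"
  assumes "invertible A" and "c \<noteq> 0"
  shows "invertible (cscale c (transpose A))"
proof -
  obtain B where B: "A ** B = mat 1" "B ** A = mat 1"
    using assms(1) unfolding invertible_def by blast
  have cs: "cscale a X ** cscale b Y = cscale (a * b) (X ** Y)" for a b and X Y :: "complex ^ 'n ^ 'n"
    by (simp add: cscale_def map_matrix_def matrix_matrix_mult_def vec_eq_iff sum_distrib_left mult_ac)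
  have one: "cscale 1 X = X" for X :: "complex ^ 'n ^ 'n"
    by (simp add: cscale_def map_matrix_def vec_eq_iff)
  have "cscale c (transpose A) ** cscale (inverse c) (transpose B) = mat 1"
    and "cscale (inverse c) (transpose B) ** cscale c (transpose A) = mat 1"
    using B assms(2) by (simp_all add: cs one matrix_transpose_mul[symmetric] transpose_mat)
  then show ?thesis
    unfolding invertible_def by blast
qed

lemma AutD:
  assumes "\<phi> \<in> Aut \<Omega>"
  shows "\<phi> ` \<Omega> = \<Omega>" and "inj_on \<phi> \<Omega>"
    and "(\<lambda>z. \<phi> z $ l) mholomorphic_on \<Omega>"
    and "(\<lambda>z. inv_into \<Omega> \<phi> z $ l) mholomorphic_on \<Omega>"
  using assms by (auto simp: Aut_def bij_betw_def)

lemma Aut_image: "\<phi> \<in> Aut \<Omega> \<Longrightarrow> z \<in> \<Omega> \<Longrightarrow> \<phi> z \<in> \<Omega>"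
  using AutD(1) by blast

lemma continuous_on_Aut:
  fixes \<Omega> :: "(complex ^ 'm) set"
  assumes "\<phi> \<in> Aut \<Omega>" shows "continuous_on \<Omega> \<phi>"
proof -
  have "continuous_on \<Omega> (\<lambda>z. \<chi> l. \<phi> z $ l)"
    by (intro continuous_on_vec_lambda mholomorphic_on_imp_continuous_on AutD(3)[OF assms])
  then show ?thesis by simp
qed

lemma pd_coordinate:
  fixes z :: "complex ^ 'm"
  shows "pd i (\<lambda>z. z $ l) z = (if l = i then 1 else 0)"
proof -
  have "((\<lambda>z::complex ^ 'm. z $ l) has_derivative (\<lambda>v. v $ l)) (at z)"
    by (intro bounded_linear_imp_has_derivative bounded_linear_vec_nth)
  from pd_eq[OF this] show ?thesis by (simp add: axis_def)
qed

text \<open>The chain rule for the inverse automorphism composed with \<open>\<phi>\<close> exhibits a left inverse.\<close>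

lemma invertible_jacobian_matrix_Aut:
  fixes \<Omega> :: "(complex ^ 'm) set"
  assumes "open \<Omega>" and \<phi>: "\<phi> \<in> Aut \<Omega>" and z: "z \<in> \<Omega>"
  shows "invertible (jacobian_matrix \<phi> z)"
proof -
  define \<psi> where "\<psi> = inv_into \<Omega> \<phi>"
  have \<phi>z: "\<phi> ` \<Omega> \<subseteq> \<Omega>" using AutD(1)[OF \<phi>] by simp
  have \<psi>: "(\<lambda>z. \<psi> z $ l) mholomorphic_on \<Omega>" for l
    unfolding \<psi>_def by (rule AutD(4)[OF \<phi>])
  have "(jacobian_matrix \<psi> (\<phi> z) ** jacobian_matrix \<phi> z) $ l $ i = mat 1 $ l $ i" for l i
  proof -
    have "(jacobian_matrix \<psi> (\<phi> z) ** jacobian_matrix \<phi> z) $ l $ i = pd i (\<lambda>x. \<psi> (\<phi> x) $ l) z"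
      using pd_compose[OF \<psi> AutD(3)[OF \<phi>] \<phi>z z]
      by (simp add: matrix_matrix_mult_def jacobian_matrix_def)
    also have "\<dots> = pd i (\<lambda>x. x $ l) z"
    proof (rule pd_cong_open[OF \<open>open \<Omega>\<close> z mholomorphic_on_compose[OF \<psi> AutD(3)[OF \<phi>] \<phi>z]])
      show "\<psi> (\<phi> x) $ l = x $ l" if "x \<in> \<Omega>" for x
        using that AutD(2)[OF \<phi>] by (simp add: \<psi>_def inv_into_f_f)
    qed
    also have "\<dots> = mat 1 $ l $ i" by (simp add: pd_coordinate mat_def)
    finally show ?thesis .
  qed
  then have "jacobian_matrix \<psi> (\<phi> z) ** jacobian_matrix \<phi> z = mat 1"
    by (simp add: vec_eq_iff)
  then show ?thesis
    unfolding invertible_def using matrix_left_right_inverse by blast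
qed

lemma matrix_1_mult_component:
  fixes A B :: "complex ^ 1 ^ 1"
  shows "(A ** B) $ 1 $ 1 = A $ 1 $ 1 * B $ 1 $ 1"
  by (simp add: matrix_matrix_mult_def)

lemma quasi_invariant_scalarD:
  assumes "quasi_invariant \<Omega> (\<lambda>\<phi> z. scalar_matrix (J \<phi> z)) (\<lambda>z w. scalar_matrix (K z w))"
    and "\<phi> \<in> Aut \<Omega>" "z \<in> \<Omega>" "w \<in> \<Omega>"
  shows "J \<phi> z * K (\<phi> z) (\<phi> w) * cnj (J \<phi> w) = K z w"
proof -
  have "scalar_matrix (J \<phi> z) ** scalar_matrix (K (\<phi> z) (\<phi> w)) ** adjoint_matrix (scalar_matrix (J \<phi> w))
      = scalar_matrix (K z w)"
    using assms unfolding quasi_invariant_def by blast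
  then have "(scalar_matrix (J \<phi> z) ** scalar_matrix (K (\<phi> z) (\<phi> w))
      ** adjoint_matrix (scalar_matrix (J \<phi> w))) $ 1 $ 1 = scalar_matrix (K z w) $ 1 $ 1"
    by simp
  then show ?thesis
    by (simp add: matrix_1_mult_component scalar_matrix_def mat_def adjoint_matrix_def transpose_def
        map_matrix_def)
qed

lemma nonneg_definite_scalar_diagonal:
  assumes "nonneg_definite \<Omega> (\<lambda>z w. scalar_matrix (K z w))" and "z \<in> \<Omega>"
  shows "K z z \<in> \<real>\<^sub>\<ge>\<^sub>0"
proof -
  have "(\<Sum>p<(1::nat). \<Sum>q<(1::nat). cinner (scalar_matrix (K z z) *v (1 :: complex ^ 1)) 1) \<in> \<real>\<^sub>\<ge>\<^sub>0"
    using assms(1)[unfolded nonneg_definite_def, rule_format, of 1 "\<lambda>_. z" "\<lambda>_. 1"] assms(2) by simp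
  then show ?thesis
    by (simp add: cinner_def scalar_matrix_def mat_def matrix_vector_mult_def)
qed

section \<open>Multipliers and logarithms of kernels\<close>

text \<open>Logarithms of \<open>1\<close> lie in \<open>2 \<pi> \<i> \<int>\<close>, a discrete set, and a continuous function with discrete
  range is constant on a connected set.\<close>

lemma continuous_logarithm_of_1_constant:
  fixes d :: "'a::topological_space \<Rightarrow> complex"
  assumes "connected S" and "continuous_on S d" and "\<And>p. p \<in> S \<Longrightarrow> exp (d p) = 1"
  shows "d constant_on S"
proof (rule continuous_discrete_range_constant[OF assms(1,2)])
  fix p assume p: "p \<in> S"
  have "2 * pi \<le> norm (d q - d p)" if "q \<in> S" "d q \<noteq> d p" for q
  proof -
    have "exp (d q - d p) = 1"
      using assms(3) p that by (simp add: exp_diff)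
    then obtain n :: int where n: "Re (d q - d p) = 0" "Im (d q - d p) = of_int (2 * n) * pi"
      unfolding exp_eq_1 by blast
    have "n \<noteq> 0"
    proof
      assume "n = 0"
      with n have "d q - d p = 0" by (simp add: complex_eq_iff)
      with that show False by simp
    qed
    then have "1 \<le> \<bar>real_of_int n\<bar>" by linarith
    then have "2 * pi \<le> \<bar>Im (d q - d p)\<bar>"
      unfolding n by (simp add: abs_mult)
    then show ?thesis
      using abs_Im_le_cmod[of "d q - d p"] by linarith
  qed
  then show "\<exists>e>0. \<forall>q. q \<in> S \<and> d q \<noteq> d p \<longrightarrow> e \<le> norm (d q - d p)"
    by (intro exI[of _ "2 * pi"]) auto
qed

lemma cont_log_kernel_mholomorphic:
  assumes "open \<Omega>" and "sesqui_analytic \<Omega> K" and "cont_log_kernel \<Omega> K logK"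
  shows "w \<in> \<Omega> \<Longrightarrow> (\<lambda>z. logK z w) mholomorphic_on \<Omega>"
    and "z \<in> \<Omega> \<Longrightarrow> (\<lambda>w. cnj (logK z w)) mholomorphic_on \<Omega>"
proof -
  have cont: "continuous_on (\<Omega> \<times> \<Omega>) (\<lambda>q. (\<lambda>(z, w). logK z w) q)"
    and ex: "\<And>z w. z \<in> \<Omega> \<Longrightarrow> w \<in> \<Omega> \<Longrightarrow> exp (logK z w) = K z w"
    using assms(3) by (auto simp: cont_log_kernel_def)
  show "(\<lambda>z. logK z w) mholomorphic_on \<Omega>" if w: "w \<in> \<Omega>"
  proof (rule mholomorphic_on_logarithm[OF _ \<open>open \<Omega>\<close>])
    show "(\<lambda>z. K z w) mholomorphic_on \<Omega>"
      using assms(2) w by (simp add: sesqui_analytic_def)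
    have "continuous_on \<Omega> (\<lambda>z. (\<lambda>(z, w). logK z w) (z, w))"
      by (rule continuous_on_compose2[OF cont continuous_on_Pair[OF continuous_on_id continuous_on_const]])
         (use w in auto)
    then show "continuous_on \<Omega> (\<lambda>z. logK z w)" by simp
  qed (simp add: ex w)
  show "(\<lambda>w. cnj (logK z w)) mholomorphic_on \<Omega>" if z: "z \<in> \<Omega>"
  proof (rule mholomorphic_on_logarithm[OF _ \<open>open \<Omega>\<close>])
    show "(\<lambda>w. cnj (K z w)) mholomorphic_on \<Omega>"
      using assms(2) z by (simp add: sesqui_analytic_def)
    show "continuous_on \<Omega> (\<lambda>w. cnj (logK z w))"
      by (rule continuous_on_cnj[OF continuous_on_slice[OF cont z]])
  qed (simp add: ex z exp_cnj[symmetric])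
qed

text \<open>Freezing one variable in the quasi-invariance of \<open>K\<close> expresses \<open>J \<phi>\<close> through values of \<open>K\<close>,
  whose logarithm is available, and the nonzero constant \<open>J \<phi> w\<close>. So \<open>J \<phi>\<close> has a logarithm
  on \<open>\<Omega>\<close>, which may have nontrivial topology.\<close>

lemma holo_log_multiplier_exists:
  fixes \<Omega> :: "(complex ^ 'm) set"
  assumes "open \<Omega>" and "\<Omega> \<noteq> {}" and log: "cont_log_kernel \<Omega> K logK"
    and J: "J \<phi> mholomorphic_on \<Omega>" "\<And>z. z \<in> \<Omega> \<Longrightarrow> J \<phi> z \<noteq> 0"
    and qi: "quasi_invariant \<Omega> (\<lambda>\<phi> z. scalar_matrix (J \<phi> z)) (\<lambda>z w. scalar_matrix (K z w))"
    and \<phi>: "\<phi> \<in> Aut \<Omega>"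
  shows "\<exists>l. holo_log \<Omega> (J \<phi>) l"
proof -
  obtain w where w: "w \<in> \<Omega>" using \<open>\<Omega> \<noteq> {}\<close> by blast
  have cont: "continuous_on (\<Omega> \<times> \<Omega>) (\<lambda>(z, w). logK z w)"
    and ex: "\<And>z w. z \<in> \<Omega> \<Longrightarrow> w \<in> \<Omega> \<Longrightarrow> exp (logK z w) = K z w"
    using log by (auto simp: cont_log_kernel_def)
  define l where "l z = logK z w - logK (\<phi> z) (\<phi> w) - Ln (cnj (J \<phi> w))" for z
  have exp_l: "exp (l z) = J \<phi> z" if z: "z \<in> \<Omega>" for z
  proof -
    have "K (\<phi> z) (\<phi> w) \<noteq> 0"
      using ex[OF Aut_image[OF \<phi> z] Aut_image[OF \<phi> w]] exp_not_eq_zero by metis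
    moreover have "exp (l z) = K z w / K (\<phi> z) (\<phi> w) / cnj (J \<phi> w)"
      using J(2)[OF w] z w \<phi> by (simp add: l_def exp_diff ex Aut_image)
    ultimately show ?thesis
      using J(2)[OF w] by (simp add: quasi_invariant_scalarD[OF qi \<phi> z w, symmetric])
  qed
  have "continuous_on \<Omega> (\<lambda>z. (\<lambda>(z, w). logK z w) (z, w))"
    by (rule continuous_on_compose2[OF cont]) (use w in \<open>auto intro!: continuous_intros\<close>)
  moreover have "continuous_on \<Omega> (\<lambda>z. (\<lambda>(z, w). logK z w) (\<phi> z, \<phi> w))"
    by (rule continuous_on_compose2[OF cont])
       (use w Aut_image[OF \<phi>] in \<open>auto intro!: continuous_intros continuous_on_Aut[OF \<phi>]\<close>)
  ultimately have "continuous_on \<Omega> l"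
    unfolding l_def by (auto intro!: continuous_intros)
  then have "l mholomorphic_on \<Omega>"
    by (rule mholomorphic_on_logarithm[OF J(1) \<open>open \<Omega>\<close>]) (rule exp_l)
  then show ?thesis
    using exp_l unfolding holo_log_def by blast
qed

text \<open>Taking logarithms in the quasi-invariance of \<open>K\<close> gives this identity up to a constant in
  \<open>2 \<pi> \<i> \<int>\<close>. An arbitrary such constant would spoil the powers with exponent \<open>t\<close>. It vanishes
  by a look at the diagonal: there \<open>K\<close> is positive, so the imaginary part of \<open>logK\<close> is the same
  at all diagonal points, in particular at \<open>(z, z)\<close> and \<open>(\<phi> z, \<phi> z)\<close>, whereas
  \<open>l z + cnj (l z)\<close> is real.\<close>

lemma log_kernel_transformation:
  fixes \<Omega> :: "(complex ^ 'm) set"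
  assumes "connected \<Omega>" and log: "cont_log_kernel \<Omega> K logK"
    and pos: "nonneg_definite \<Omega> (\<lambda>z w. scalar_matrix (K z w))"
    and qi: "quasi_invariant \<Omega> (\<lambda>\<phi> z. scalar_matrix (J \<phi> z)) (\<lambda>z w. scalar_matrix (K z w))"
    and \<phi>: "\<phi> \<in> Aut \<Omega>" and l: "holo_log \<Omega> (J \<phi>) l"
    and zw: "z \<in> \<Omega>" "w \<in> \<Omega>"
  shows "logK z w = logK (\<phi> z) (\<phi> w) + l z + cnj (l w)"
proof -
  have cont: "continuous_on (\<Omega> \<times> \<Omega>) (\<lambda>(z, w). logK z w)"
    and ex: "\<And>z w. z \<in> \<Omega> \<Longrightarrow> w \<in> \<Omega> \<Longrightarrow> exp (logK z w) = K z w"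
    using log by (auto simp: cont_log_kernel_def)
  have l': "continuous_on \<Omega> l" "\<And>z. z \<in> \<Omega> \<Longrightarrow> exp (l z) = J \<phi> z"
    using l by (auto simp: holo_log_def intro: mholomorphic_on_imp_continuous_on)
  note im = Aut_image[OF \<phi>]
  define d where "d = (\<lambda>(z, w). logK (\<phi> z) (\<phi> w) + l z + cnj (l w) - logK z w)"
  have exp_d: "exp (d (z, w)) = 1" if zw: "z \<in> \<Omega>" "w \<in> \<Omega>" for z w
  proof -
    have "exp (d (z, w)) = J \<phi> z * K (\<phi> z) (\<phi> w) * cnj (J \<phi> w) / K z w"
      using zw by (simp add: d_def exp_add exp_diff ex l'(2) im exp_cnj[symmetric])
    also have "\<dots> = 1"
      using ex[OF zw] exp_not_eq_zero[of "logK z w"]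
      by (simp add: quasi_invariant_scalarD[OF qi \<phi> zw])
    finally show ?thesis .
  qed
  have "d constant_on \<Omega> \<times> \<Omega>"
  proof (rule continuous_logarithm_of_1_constant)
    show "connected (\<Omega> \<times> \<Omega>)" using \<open>connected \<Omega>\<close> by (simp add: connected_Times)
    have "continuous_on (\<Omega> \<times> \<Omega>) (\<lambda>q. (\<lambda>(z, w). logK z w) (\<phi> (fst q), \<phi> (snd q)))"
    proof (rule continuous_on_compose2[OF cont])
      show "continuous_on (\<Omega> \<times> \<Omega>) (\<lambda>q. (\<phi> (fst q), \<phi> (snd q)))"
        by (intro continuous_on_Pair continuous_on_compose2[OF continuous_on_Aut[OF \<phi>]]
            continuous_on_fst continuous_on_snd continuous_on_id) auto
    qed (use im in auto)
    moreover have "continuous_on (\<Omega> \<times> \<Omega>) (\<lambda>q. l (fst q))" "continuous_on (\<Omega> \<times> \<Omega>) (\<lambda>q. l (snd q))"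
      by (auto intro!: continuous_on_compose2[OF l'(1)] continuous_intros)
    ultimately show "continuous_on (\<Omega> \<times> \<Omega>) d"
      using cont unfolding d_def split_beta fst_conv snd_conv by (intro continuous_intros)
    show "exp (d q) = 1" if "q \<in> \<Omega> \<times> \<Omega>" for q
      using that exp_d by auto
  qed
  then obtain c where c: "\<And>z w. z \<in> \<Omega> \<Longrightarrow> w \<in> \<Omega> \<Longrightarrow> d (z, w) = c"
    unfolding constant_on_def by blast
  (* Twice the imaginary part of logK on the diagonal, times \<i>. *)
  have "(\<lambda>z. logK z z - cnj (logK z z)) constant_on \<Omega>"
  proof (rule continuous_logarithm_of_1_constant[OF \<open>connected \<Omega>\<close>])
    have "continuous_on \<Omega> (\<lambda>z. (\<lambda>(z, w). logK z w) (z, z))"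
      by (rule continuous_on_compose2[OF cont]) (auto intro!: continuous_intros)
    then show "continuous_on \<Omega> (\<lambda>z. logK z z - cnj (logK z z))"
      by (auto intro!: continuous_intros)
    show "exp (logK z z - cnj (logK z z)) = 1" if z: "z \<in> \<Omega>" for z
    proof -
      have "K z z \<in> \<real>"
        using nonneg_definite_scalar_diagonal[OF pos z] nonneg_Reals_subset_Reals by blast
      then have "cnj (K z z) = K z z" by (simp add: Reals_cnj_iff)
      then show ?thesis
        using ex[OF z z] exp_not_eq_zero[of "logK z z"] by (simp add: exp_diff exp_cnj[symmetric])
    qed
  qed
  then obtain b where b: "\<And>z. z \<in> \<Omega> \<Longrightarrow> logK z z - cnj (logK z z) = b"
    unfolding constant_on_def by blast
  have "c - cnj c = (logK (\<phi> z) (\<phi> z) - cnj (logK (\<phi> z) (\<phi> z))) - (logK z z - cnj (logK z z))"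
    using c[OF zw(1) zw(1)] by (auto simp: d_def)
  also have "\<dots> = 0"
    by (simp only: b im zw) simp
  finally have "c - cnj c = 0" .
  moreover have "Re c = 0"
    using exp_d[OF zw] c[OF zw] by (simp add: exp_eq_1)
  ultimately have "c = 0"
    by (simp add: complex_eq_iff)
  then show ?thesis
    using c[OF zw] by (simp add: d_def)
qed

text \<open>Both terms \<open>l z\<close> and \<open>cnj (l w)\<close> depend on one variable only and disappear in the mixed
  derivative: the first in the derivative with respect to the conjugate of \<open>w\<close>, the second, which
  leaves a constant, in the derivative with respect to \<open>z\<close>. What remains is the chain rule in each
  variable.\<close>

lemma curvature_transformation:
  fixes \<Omega> :: "(complex ^ 'm) set"
  assumes "open \<Omega>" and "sesqui_analytic \<Omega> K" and log: "cont_log_kernel \<Omega> K logK"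
    and \<phi>: "\<phi> \<in> Aut \<Omega>" and l: "l mholomorphic_on \<Omega>"
    and trans: "\<And>z w. z \<in> \<Omega> \<Longrightarrow> w \<in> \<Omega> \<Longrightarrow> logK z w = logK (\<phi> z) (\<phi> w) + l z + cnj (l w)"
    and z: "z \<in> \<Omega>" and w: "w \<in> \<Omega>"
  shows "pd i (\<lambda>x. pd_bar j (\<lambda>y. logK x y) w) z =
    (\<Sum>b\<in>UNIV. (\<Sum>a\<in>UNIV. jacobian_matrix \<phi> z $ a $ i *
      pd a (\<lambda>x. pd_bar b (\<lambda>y. logK x y) (\<phi> w)) (\<phi> z)) * cnj (jacobian_matrix \<phi> w $ b $ j))"
proof -
  note im = Aut_image[OF \<phi>]
  have sub: "\<phi> ` \<Omega> \<subseteq> \<Omega>" using im by blast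
  have cont: "continuous_on (\<Omega> \<times> \<Omega>) (\<lambda>(z, w). logK z w)"
    using log by (simp add: cont_log_kernel_def)
  note holo = cont_log_kernel_mholomorphic(1)[OF assms(1,2) log]
    and anti = cont_log_kernel_mholomorphic(2)[OF assms(1,2) log]
  define G where "G b x = pd_bar b (logK x) (\<phi> w)" for b x
  have G: "G b mholomorphic_on \<Omega>" for b
    unfolding G_def
    by (rule mholomorphic_on_pd_bar[OF assms(1,1) cont holo anti im[OF w]])
  have first: "pd_bar j (logK x) w =
      (\<Sum>b\<in>UNIV. cnj (jacobian_matrix \<phi> w $ b $ j) * G b (\<phi> x)) + cnj (pd j l w)"
    if x: "x \<in> \<Omega>" for x
  proof -
    note comp = mholomorphic_on_compose[OF anti[OF im[OF x]] AutD(3)[OF \<phi>] sub]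
    have "pd j (\<lambda>y. cnj (logK x y)) w = pd j (\<lambda>y. cnj (logK (\<phi> x) (\<phi> y)) + (cnj (l x) + l y)) w"
      by (rule pd_cong_open[OF \<open>open \<Omega>\<close> w anti[OF x]]) (simp add: trans x)
    also have "\<dots> = pd j (\<lambda>y. cnj (logK (\<phi> x) (\<phi> y))) w + pd j l w"
      using pd_add[OF comp mholomorphic_on_add[OF mholomorphic_on_const l] w]
        pd_add[OF mholomorphic_on_const l w]
      by (simp add: pd_const)
    also have "pd j (\<lambda>y. cnj (logK (\<phi> x) (\<phi> y))) w =
        (\<Sum>b\<in>UNIV. pd b (\<lambda>y. cnj (logK (\<phi> x) y)) (\<phi> w) * jacobian_matrix \<phi> w $ b $ j)"
      by (rule pd_compose[OF anti[OF im[OF x]] AutD(3)[OF \<phi>] sub w])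
    finally show ?thesis
      by (simp add: pd_bar_eq_cnj_pd[OF anti[OF x] w] G_def
          pd_bar_eq_cnj_pd[OF anti[OF im[OF x]] im[OF w]] mult.commute)
  qed
  have Gc: "(\<lambda>x. cnj (jacobian_matrix \<phi> w $ b $ j) * G b (\<phi> x)) mholomorphic_on \<Omega>" for b
    by (rule mholomorphic_on_cmult[OF mholomorphic_on_compose[OF G AutD(3)[OF \<phi>] sub]])
  have "pd i (\<lambda>x. pd_bar j (logK x) w) z =
      pd i (\<lambda>x. (\<Sum>b\<in>UNIV. cnj (jacobian_matrix \<phi> w $ b $ j) * G b (\<phi> x)) + cnj (pd j l w)) z"
    by (rule pd_cong_open[OF \<open>open \<Omega>\<close> z mholomorphic_on_pd_bar[OF assms(1,1) cont holo anti w] first])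
  also have "\<dots> = (\<Sum>b\<in>UNIV. pd i (\<lambda>x. cnj (jacobian_matrix \<phi> w $ b $ j) * G b (\<phi> x)) z)"
    by (simp only: pd_add[OF mholomorphic_on_sum[OF Gc] mholomorphic_on_const z] pd_sum[OF Gc z]
        pd_const add_0_right)
  also have "\<dots> = (\<Sum>b\<in>UNIV. cnj (jacobian_matrix \<phi> w $ b $ j) *
      (\<Sum>a\<in>UNIV. pd a (G b) (\<phi> z) * jacobian_matrix \<phi> z $ a $ i))"
    by (simp only: pd_cmult[OF mholomorphic_on_compose[OF G AutD(3)[OF \<phi>] sub] z]
        pd_compose[OF G AutD(3)[OF \<phi>] sub z])
  finally show ?thesis
    by (simp add: G_def[abs_def] mult.commute)
qed

section \<open>Quasi-invariance of the curvature kernel\<close>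

theorem proposition6p2:
  fixes \<Omega> :: "(complex ^ 'm) set"
    and K logK :: "complex ^ 'm \<Rightarrow> complex ^ 'm \<Rightarrow> complex"
    and J :: "(complex ^ 'm \<Rightarrow> complex ^ 'm) \<Rightarrow> complex ^ 'm \<Rightarrow> complex"
    and t :: real
  assumes "open \<Omega>" and "connected \<Omega>" and "\<Omega> \<noteq> {}" and "bounded \<Omega>"
    and "sesqui_analytic \<Omega> K"
    and "nonneg_definite \<Omega> (\<lambda>z w. scalar_matrix (K z w))"
    and "cont_log_kernel \<Omega> K logK"
    and "\<forall>\<phi>\<in>Aut \<Omega>. J \<phi> mholomorphic_on \<Omega> \<and> (\<forall>z\<in>\<Omega>. J \<phi> z \<noteq> 0)"
    and "quasi_invariant \<Omega> (\<lambda>\<phi> z. scalar_matrix (J \<phi> z)) (\<lambda>z w. scalar_matrix (K z w))"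
    and "t \<in> gen_Wallach_set \<Omega> logK"
  shows "(\<forall>\<phi>\<in>Aut \<Omega>. \<exists>l. holo_log \<Omega> (J \<phi>) l) \<and>
    (\<forall>logJ. (\<forall>\<phi>\<in>Aut \<Omega>. holo_log \<Omega> (J \<phi>) (logJ \<phi>)) \<longrightarrow>
      quasi_invariant \<Omega>
        (\<lambda>\<phi> z. cscale (exp (of_real t * logJ \<phi> z)) (transpose (jacobian_matrix \<phi> z)))
        (curvature_kernel t logK))"
proof (intro conjI ballI allI impI)
  fix \<phi> assume "\<phi> \<in> Aut \<Omega>"
  then show "\<exists>l. holo_log \<Omega> (J \<phi>) l"
    using assms(8) by (intro holo_log_multiplier_exists[OF assms(1,3,7) _ _ assms(9)]) auto
next
  fix logJ assume logJ: "\<forall>\<phi>\<in>Aut \<Omega>. holo_log \<Omega> (J \<phi>) (logJ \<phi>)"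
  let ?JJ = "\<lambda>\<phi> z. cscale (exp (of_real t * logJ \<phi> z)) (transpose (jacobian_matrix \<phi> z))"
  have inv: "invertible (?JJ \<phi> z)" if "\<phi> \<in> Aut \<Omega>" "z \<in> \<Omega>" for \<phi> z
    by (rule invertible_cscale_transpose[OF invertible_jacobian_matrix_Aut[OF assms(1) that]]) simp
  have holo: "(\<lambda>z. ?JJ \<phi> z $ a $ b) mholomorphic_on \<Omega>" if \<phi>: "\<phi> \<in> Aut \<Omega>" for \<phi> a b
  proof -
    have "logJ \<phi> mholomorphic_on \<Omega>"
      using logJ \<phi> by (simp add: holo_log_def)
    then have "(\<lambda>z. exp (of_real t * logJ \<phi> z) * pd a (\<lambda>x. \<phi> x $ b) z) mholomorphic_on \<Omega>"
      by (intro mholomorphic_on_mult mholomorphic_on_exp mholomorphic_on_cmult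
          mholomorphic_on_pd[OF assms(1) AutD(3)[OF \<phi>]])
    then show ?thesis
      by (simp add: cscale_def map_matrix_def transpose_def jacobian_matrix_def)
  qed
  have trans: "?JJ \<phi> z ** curvature_kernel t logK (\<phi> z) (\<phi> w) ** adjoint_matrix (?JJ \<phi> w)
      = curvature_kernel t logK z w"
    if \<phi>: "\<phi> \<in> Aut \<Omega>" and zw: "z \<in> \<Omega>" "w \<in> \<Omega>" for \<phi> z w
  proof -
    have l: "holo_log \<Omega> (J \<phi>) (logJ \<phi>)" using logJ \<phi> by blast
    then have l': "logJ \<phi> mholomorphic_on \<Omega>" by (simp add: holo_log_def)
    note log = log_kernel_transformation[OF assms(2,7,6,9) \<phi> l]
    have factor: "exp (of_real t * logJ \<phi> z) * exp (of_real t * logK (\<phi> z) (\<phi> w)) *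
        cnj (exp (of_real t * logJ \<phi> w)) = exp (of_real t * logK z w)"
      by (simp add: log[OF zw] exp_cnj exp_add[symmetric] algebra_simps)
    define M where "M a b = pd a (\<lambda>x. pd_bar b (\<lambda>y. logK x y) (\<phi> w)) (\<phi> z)" for a b
    have "(?JJ \<phi> z ** curvature_kernel t logK (\<phi> z) (\<phi> w) ** adjoint_matrix (?JJ \<phi> w)) $ i $ j
        = curvature_kernel t logK z w $ i $ j" for i j
    proof -
      have "(?JJ \<phi> z ** curvature_kernel t logK (\<phi> z) (\<phi> w) ** adjoint_matrix (?JJ \<phi> w)) $ i $ j
          = (\<Sum>b\<in>UNIV. (\<Sum>a\<in>UNIV. (exp (of_real t * logJ \<phi> z) * jacobian_matrix \<phi> z $ a $ i) *
              (exp (of_real t * logK (\<phi> z) (\<phi> w)) * M a b)) *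
              cnj (exp (of_real t * logJ \<phi> w) * jacobian_matrix \<phi> w $ b $ j))"
        by (simp add: cscale_def map_matrix_def matrix_matrix_mult_def adjoint_matrix_def
            transpose_def curvature_kernel_def M_def)
      also have "\<dots> = (exp (of_real t * logJ \<phi> z) * exp (of_real t * logK (\<phi> z) (\<phi> w)) *
          cnj (exp (of_real t * logJ \<phi> w))) *
          (\<Sum>b\<in>UNIV. (\<Sum>a\<in>UNIV. jacobian_matrix \<phi> z $ a $ i * M a b) * cnj (jacobian_matrix \<phi> w $ b $ j))"
        by (simp add: sum_distrib_left sum_distrib_right mult_ac)
      also have "\<dots> = exp (of_real t * logK z w) * pd i (\<lambda>x. pd_bar j (\<lambda>y. logK x y) w) z"
        unfolding factor M_def
        using curvature_transformation[OF assms(1,5,7) \<phi> l' log zw] by simp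
      finally show ?thesis
        by (simp add: curvature_kernel_def cscale_def map_matrix_def)
    qed
    then show ?thesis by (simp add: vec_eq_iff)
  qed
  show "quasi_invariant \<Omega> ?JJ (curvature_kernel t logK)"
    unfolding quasi_invariant_def
    using inv holo trans assms(10) by (simp add: gen_Wallach_set_def)
qed

end
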